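(* Let $\mathcal{X}\subseteq\mathbb{R}^d$ be a compact convex set with nonempty interior and with $0\notin\mathcal{X}$. Let $\Delta$ be a set and let $\{a_\delta\}_{\delta\in\Delta}$, $\{b_\delta\}_{\delta\in\Delta}$ be collections of vectors in $\mathbb{R}^d$ such that $b_\delta^\top x>0$ for all $x\in\mathcal{X}$ and $\delta\in\Delta$. Let $c:\mathcal{X}\to\mathbb{R}$ be a strongly convex function. For a finite set $\omega\subseteq\Delta$, let $\mathcal{P}(\omega)$ be the sampled quasi-linear optimization problem $$\min_{x\in\mathbb{R}^d,\ \lambda\ge 0}\ (\lambda,c(x))\quad\text{s.t.}\quad x\in\mathcal{X},\quad a_\delta^\top x\le\lambda\, b_\delta^\top x\ \ \forall\,\delta\in\omega,$$ where the minimum is with respect to the lexicographical order. Then, for every finite $\omega\subseteq\Delta$, every essential set $\beta$ of $\mathcal{P}(\omega)$ satisfies $|\beta|\le d$.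
   Context: Lexicographical order: $(\lambda_1,c_1)<(\lambda_2,c_2)$ if $\lambda_1<\lambda_2$, or else $\lambda_1=\lambda_2$ and $c_1<c_2$. For finite $\omega\subseteq\Delta$, $\mathrm{Opt}(\omega)$ denotes the optimal solution $(\lambda^*,x^* )$ of $\mathcal{P}(\omega)$ (unique by strong convexity of $c$), and $\mathrm{Cost}(\omega)=(\lambda^*,c(x^* ))$ denotes its optimal cost. Essential set: an essential set for $\mathcal{P}(\omega)$ is a set $\beta\subseteq\omega$ satisfying $\mathrm{Cost}(\beta)=\mathrm{Cost}(\omega)$, and with minimal cardinality among the subsets of $\omega$ with this property. *)

theory Defs
  imports "HOL-Analysis.Analysis"
begin

definition strongly_convex_on :: "'v::real_normed_vector set \<Rightarrow> ('v \<Rightarrow> real) \<Rightarrow> bool" where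
  "strongly_convex_on S f \<longleftrightarrow> convex S \<and>
     (\<exists>m>0. \<forall>x\<in>S. \<forall>y\<in>S. \<forall>t\<in>{0..1}.
        f ((1 - t) *\<^sub>R x + t *\<^sub>R y)
          \<le> (1 - t) * f x + t * f y - m / 2 * t * (1 - t) * (norm (x - y))\<^sup>2)"

(* Pairs of reals are ordered componentwise in HOL-Analysis, so the lexicographical order
   is a separate relation. *)

definition lex_less :: "real \<times> real \<Rightarrow> real \<times> real \<Rightarrow> bool" where
  "lex_less u v \<longleftrightarrow> fst u < fst v \<or> (fst u = fst v \<and> snd u < snd v)"

definition lex_le :: "real \<times> real \<Rightarrow> real \<times> real \<Rightarrow> bool" where
  "lex_le u v \<longleftrightarrow> lex_less u v \<or> u = v"

(* The points are pairs (l, x), where l is the quasi-linear parameter lambda. *)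

definition feasible ::
  "(real^'d) set \<Rightarrow> ('i \<Rightarrow> real^'d) \<Rightarrow> ('i \<Rightarrow> real^'d) \<Rightarrow> 'i set \<Rightarrow> (real \<times> (real^'d)) set" where
  "feasible X a b \<omega> =
     {(l, x). 0 \<le> l \<and> x \<in> X \<and> (\<forall>\<delta>\<in>\<omega>. a \<delta> \<bullet> x \<le> l * (b \<delta> \<bullet> x))}"

definition objective :: "(real^'d \<Rightarrow> real) \<Rightarrow> real \<times> (real^'d) \<Rightarrow> real \<times> real" where
  "objective c p = (fst p, c (snd p))"

definition is_optimal ::
  "(real^'d) set \<Rightarrow> ('i \<Rightarrow> real^'d) \<Rightarrow> ('i \<Rightarrow> real^'d) \<Rightarrow> (real^'d \<Rightarrow> real) \<Rightarrow> 'i set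
     \<Rightarrow> real \<times> (real^'d) \<Rightarrow> bool" where
  "is_optimal X a b c \<omega> p \<longleftrightarrow>
     p \<in> feasible X a b \<omega> \<and>
     (\<forall>q\<in>feasible X a b \<omega>. lex_le (objective c p) (objective c q))"

definition Opt ::
  "(real^'d) set \<Rightarrow> ('i \<Rightarrow> real^'d) \<Rightarrow> ('i \<Rightarrow> real^'d) \<Rightarrow> (real^'d \<Rightarrow> real) \<Rightarrow> 'i set
     \<Rightarrow> real \<times> (real^'d)" where
  "Opt X a b c \<omega> = (THE p. is_optimal X a b c \<omega> p)"

(* A real-valued convex function on a compact convex set may fail to be lower semicontinuous at
   the boundary, and then the minimum need not be attained; in that case the cost is None.
   For continuous c the minimum is always attained, see is_optimal_exists below. *)

definition Cost ::
  "(real^'d) set \<Rightarrow> ('i \<Rightarrow> real^'d) \<Rightarrow> ('i \<Rightarrow> real^'d) \<Rightarrow> (real^'d \<Rightarrow> real) \<Rightarrow> 'i set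
     \<Rightarrow> (real \<times> real) option" where
  "Cost X a b c \<omega> =
     (if \<exists>p. is_optimal X a b c \<omega> p then Some (objective c (Opt X a b c \<omega>)) else None)"

definition essential_set ::
  "(real^'d) set \<Rightarrow> ('i \<Rightarrow> real^'d) \<Rightarrow> ('i \<Rightarrow> real^'d) \<Rightarrow> (real^'d \<Rightarrow> real) \<Rightarrow> 'i set
     \<Rightarrow> 'i set \<Rightarrow> bool" where
  "essential_set X a b c \<omega> \<beta> \<longleftrightarrow>
     Cost X a b c \<omega> \<noteq> None \<and>
     \<beta> \<subseteq> \<omega> \<and> Cost X a b c \<beta> = Cost X a b c \<omega> \<and>
     (\<forall>\<gamma>. \<gamma> \<subseteq> \<omega> \<and> Cost X a b c \<gamma> = Cost X a b c \<omega> \<longrightarrow> card \<beta> \<le> card \<gamma>)"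

lemma is_optimal_unique:
  assumes c: "strongly_convex_on X c"
    and p: "is_optimal X a b c \<omega> p" and q: "is_optimal X a b c \<omega> q"
  shows "p = q"
proof -
  obtain l x where px: "p = (l, x)" by (cases p)
  obtain l' y where qy: "q = (l', y)" by (cases q)
  have pf: "p \<in> feasible X a b \<omega>" and qf: "q \<in> feasible X a b \<omega>"
    using p q by (auto simp: is_optimal_def)
  have "lex_le (objective c p) (objective c q)" "lex_le (objective c q) (objective c p)"
    using p q pf qf by (auto simp: is_optimal_def)
  then have eq: "l' = l" "c y = c x"
    by (auto simp: lex_le_def lex_less_def objective_def px qy)
  have xy: "x \<in> X" "y \<in> X" using pf qf by (auto simp: feasible_def px qy)
  define z where "z = (1 - 1/2) *\<^sub>R x + (1/2::real) *\<^sub>R y"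
  have "convex X" using c by (simp add: strongly_convex_on_def)
  then have "z \<in> X" unfolding z_def using xy by (intro convexD) auto
  moreover have "a \<delta> \<bullet> z \<le> l * (b \<delta> \<bullet> z)" if "\<delta> \<in> \<omega>" for \<delta>
  proof -
    have "a \<delta> \<bullet> x \<le> l * (b \<delta> \<bullet> x)" "a \<delta> \<bullet> y \<le> l * (b \<delta> \<bullet> y)"
      using pf qf that by (auto simp: feasible_def px qy eq)
    then show ?thesis by (simp add: z_def inner_add_right algebra_simps)
  qed
  ultimately have "(l, z) \<in> feasible X a b \<omega>" using pf by (auto simp: feasible_def px)
  then have "lex_le (objective c p) (objective c (l, z))" using p by (auto simp: is_optimal_def)
  then have cz: "c x \<le> c z" by (auto simp: lex_le_def lex_less_def objective_def px)
  obtain m where m: "m > 0" and sc: "\<And>t. t \<in> {0..1} \<Longrightarrow> c ((1 - t) *\<^sub>R x + t *\<^sub>R y)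
      \<le> (1 - t) * c x + t * c y - m / 2 * t * (1 - t) * (norm (x - y))\<^sup>2"
    using c xy unfolding strongly_convex_on_def by blast
  have "c z \<le> c x - m / 8 * (norm (x - y))\<^sup>2"
    using sc[of "1/2"] unfolding z_def by (simp add: eq)
  with cz have "m / 8 * (norm (x - y))\<^sup>2 \<le> 0" by simp
  with m have "(norm (x - y))\<^sup>2 \<le> 0" by (simp add: mult_le_0_iff)
  then have "x = y" by simp
  then show ?thesis by (simp add: px qy eq)
qed

lemma is_optimal_exists:
  assumes X: "compact X" "X \<noteq> {}" and fin: "finite \<omega>"
    and b: "\<And>\<delta> x. \<delta> \<in> \<omega> \<Longrightarrow> x \<in> X \<Longrightarrow> b \<delta> \<bullet> x > 0"
    and c: "continuous_on X c"
  shows "\<exists>p. is_optimal X a b c \<omega> p"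
proof -
  obtain x0 where x0: "x0 \<in> X" using X by blast
  define L where "L = (\<Sum>\<delta>\<in>\<omega>. \<bar>a \<delta> \<bullet> x0\<bar> / (b \<delta> \<bullet> x0))"
  have L0: "0 \<le> L" unfolding L_def by (intro sum_nonneg divide_nonneg_pos) (auto simp: b x0)
  have L: "a \<delta> \<bullet> x0 \<le> L * (b \<delta> \<bullet> x0)" if "\<delta> \<in> \<omega>" for \<delta>
  proof -
    have "\<bar>a \<delta> \<bullet> x0\<bar> / (b \<delta> \<bullet> x0) \<le> L"
      unfolding L_def using that fin x0
      by (intro member_le_sum divide_nonneg_pos) (auto simp: b)
    then show ?thesis using b[OF that x0] by (simp add: pos_divide_le_eq)
  qed
  define K where "K = ({0..L} \<times> X) \<inter>
     (\<Inter>\<delta>\<in>\<omega>. {p. a \<delta> \<bullet> snd p \<le> fst p * (b \<delta> \<bullet> snd p)})"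
  have cK: "compact K" unfolding K_def
    by (intro compact_Int_closed compact_Times X compact_Icc closed_INT ballI
        closed_Collect_le continuous_intros)
  have Kf: "p \<in> K \<longleftrightarrow> p \<in> feasible X a b \<omega> \<and> fst p \<le> L" for p
    by (cases p) (auto simp: K_def feasible_def)
  have "(L, x0) \<in> K" using L0 L x0 by (auto simp: K_def)
  then obtain p1 where p1: "p1 \<in> K" "\<And>q. q \<in> K \<Longrightarrow> fst p1 \<le> fst q"
    using continuous_attains_inf[OF cK, of fst] continuous_on_fst[OF continuous_on_id] by fastforce
  define K2 where "K2 = K \<inter> {p. fst p = fst p1}"
  have cK2: "compact K2" unfolding K2_def
    by (intro compact_Int_closed cK closed_Collect_eq continuous_intros)
  have "snd ` K2 \<subseteq> X" by (auto simp: K2_def K_def)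
  then have "continuous_on K2 (\<lambda>p. c (snd p))"
    by (intro continuous_on_compose2[OF c] continuous_intros) auto
  then obtain p where p: "p \<in> K2" "\<And>q. q \<in> K2 \<Longrightarrow> c (snd p) \<le> c (snd q)"
    using continuous_attains_inf[OF cK2, of "\<lambda>p. c (snd p)"] p1(1) by (fastforce simp: K2_def)
  have "lex_le (objective c p) (objective c q)" if q: "q \<in> feasible X a b \<omega>" for q
  proof (cases "fst q \<le> fst p")
    case True
    then have "q \<in> K" using q p(1) Kf by (auto simp: K2_def)
    with p1(2)[of q] True p(1) have "fst q = fst p" "q \<in> K2" by (auto simp: K2_def)
    with p(2)[of q] show ?thesis by (auto simp: lex_le_def lex_less_def objective_def)
  qed (auto simp: lex_le_def lex_less_def objective_def)
  moreover have "p \<in> feasible X a b \<omega>" using p(1) Kf by (auto simp: K2_def)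
  ultimately show ?thesis unfolding is_optimal_def by blast
qed

lemma Cost_eq_Some:
  assumes "strongly_convex_on X c" "is_optimal X a b c \<omega> p"
  shows "Opt X a b c \<omega> = p" "Cost X a b c \<omega> = Some (objective c p)"
proof -
  show "Opt X a b c \<omega> = p"
    unfolding Opt_def using assms is_optimal_unique by blast
  moreover have "\<exists>p. is_optimal X a b c \<omega> p" using assms(2) by blast
  ultimately show "Cost X a b c \<omega> = Some (objective c p)"
    by (simp only: Cost_def if_True)
qed

end

theory Submission
  imports Defs
begin

text \<open>Put \<open>v \<delta> = a \<delta> - \<lambda>* b \<delta>\<close>. By minimality of \<open>\<beta>\<close>, each problem with one constraint \<open>\<delta> \<in> \<beta>\<close> left
  out has a feasible point \<open>x \<delta>\<close> beating the optimum, either because its parameter is smaller than \<open>\<lambda>*\<close>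
  (then \<open>v \<gamma> \<bullet> x \<delta> < 0\<close> for all \<open>\<gamma> \<noteq> \<delta>\<close>) or because \<open>c (x \<delta>) < c x*\<close> (then only \<open>v \<gamma> \<bullet> x \<delta> \<le> 0\<close>).
  If \<open>\<beta>\<close> had more than \<open>d\<close> elements, a linear dependence among the \<open>x \<delta>\<close> would, as in Radon's theorem,
  give a common point \<open>y\<close> of the cones spanned by two disjoint subfamilies, both nonempty because
  \<open>0 \<notin> X\<close>; every \<open>\<gamma>\<close> lies outside one of the subfamilies, so \<open>v \<gamma> \<bullet> y \<le> 0\<close>. If one subfamily consists of
  points of the second kind only, rescaling \<open>y\<close> into their convex hull beats the optimum in \<open>c\<close>;
  otherwise all inequalities are strict, and rescaling \<open>y\<close> into \<open>X\<close> allows a smaller parameter.\<close>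

text \<open>Indexing by \<open>I\<close> allows repeated vectors: an injective family has too many
  distinct values to be independent, and a repetition gives a relation with coefficients 1 and
  -1.\<close>

lemma linear_dependence_of_card_gt_dim:
  fixes x :: "'i \<Rightarrow> 'v::euclidean_space"
  assumes fin: "finite I" and card: "card I > DIM('v)"
  obtains u where "(\<Sum>i\<in>I. u i *\<^sub>R x i) = 0" "\<exists>i\<in>I. u i \<noteq> 0"
proof (cases "inj_on x I")
  case True
  then have "dependent (x ` I)"
    using card by (intro dependent_biggerset) (simp add: card_image)
  then obtain u where u: "(\<Sum>z\<in>x ` I. u z *\<^sub>R z) = 0" "\<exists>z\<in>x ` I. u z \<noteq> 0"
    using dependent_finite[of "x ` I"] fin by auto
  show thesis
    by (rule that[of "u \<circ> x"]) (use u True in \<open>auto simp: sum.reindex\<close>)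
next
  case False
  then obtain i j where ij: "i \<in> I" "j \<in> I" "i \<noteq> j" "x i = x j"
    by (auto simp: inj_on_def)
  have "(\<Sum>k\<in>I. (if k = i then 1 else if k = j then -1 else 0) *\<^sub>R x k)
      = (\<Sum>k\<in>{i, j}. (if k = i then 1 else if k = j then -1 else 0) *\<^sub>R x k)"
    using ij fin by (intro sum.mono_neutral_right) auto
  then show thesis
    using ij by (intro that[of "\<lambda>k. if k = i then 1 else if k = j then -1 else 0"]) auto
qed

text \<open>The quadratic term is nonnegative, so dropping it leaves ordinary convexity, which
  preserves strict upper bounds.\<close>

lemma convex_strict_sublevel:
  assumes "strongly_convex_on S f"
  shows "convex {x\<in>S. f x < k}"
proof (rule convexI)
  fix x y and u v :: real
  assume x: "x \<in> {x\<in>S. f x < k}" and y: "y \<in> {x\<in>S. f x < k}"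
    and uv: "0 \<le> u" "0 \<le> v" "u + v = 1"
  have "convex S" using assms by (simp add: strongly_convex_on_def)
  then have S: "u *\<^sub>R x + v *\<^sub>R y \<in> S" using x y uv by (auto intro: convexD)
  obtain m where m: "m > 0" and
    "\<forall>x\<in>S. \<forall>y\<in>S. \<forall>t\<in>{0..1}. f ((1 - t) *\<^sub>R x + t *\<^sub>R y)
       \<le> (1 - t) * f x + t * f y - m / 2 * t * (1 - t) * (norm (x - y))\<^sup>2"
    using assms unfolding strongly_convex_on_def by blast
  then have "f ((1 - v) *\<^sub>R x + v *\<^sub>R y)
      \<le> (1 - v) * f x + v * f y - m / 2 * v * (1 - v) * (norm (x - y))\<^sup>2"
    using x y uv by auto
  moreover have "1 - v = u" using uv by simp
  moreover have "0 \<le> m / 2 * v * u * (norm (x - y))\<^sup>2" using m uv by simp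
  ultimately have "f (u *\<^sub>R x + v *\<^sub>R y) \<le> u * f x + v * f y" by simp
  also have "\<dots> < k" using x y uv by (intro convex_bound_lt) auto
  finally show "u *\<^sub>R x + v *\<^sub>R y \<in> {x\<in>S. f x < k}" using S by simp
qed

text \<open>Division by the positive total weight makes the combination convex; this brings points
  of a cone back into the convex set spanning it.\<close>

lemma convex_normalized_sum:
  fixes x :: "'i \<Rightarrow> 'v::real_vector"
  assumes "convex S" "finite K" "K \<noteq> {}" "\<And>i. i \<in> K \<Longrightarrow> 0 < w i" "\<And>i. i \<in> K \<Longrightarrow> x i \<in> S"
  shows "(1 / sum w K) *\<^sub>R (\<Sum>i\<in>K. w i *\<^sub>R x i) \<in> S"
proof -
  have s: "0 < sum w K" using assms by (intro sum_pos) auto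
  have "(\<Sum>i\<in>K. (w i / sum w K) *\<^sub>R x i) \<in> S"
    using assms s by (intro convex_sum) (auto simp: less_imp_le simp flip: sum_divide_distrib)
  then show ?thesis by (simp add: scaleR_sum_right)
qed

lemma feasible_smaller_parameter:
  assumes "finite \<omega>" "x \<in> X" "0 < l" and b: "\<And>\<delta>. \<delta> \<in> \<omega> \<Longrightarrow> 0 < b \<delta> \<bullet> x"
    and lt: "\<And>\<delta>. \<delta> \<in> \<omega> \<Longrightarrow> a \<delta> \<bullet> x < l * (b \<delta> \<bullet> x)"
  obtains l' where "l' < l" "(l', x) \<in> feasible X a b \<omega>"
proof -
  \<comment> \<open>The largest ratio is the least parameter that \<open>x\<close> tolerates. The
    extra 0 keeps it nonnegative and covers empty \<open>\<omega>\<close>; it stays below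
    \<open>l\<close> because \<open>l\<close> is positive.\<close>
  define R where "R = insert 0 ((\<lambda>\<delta>. (a \<delta> \<bullet> x) / (b \<delta> \<bullet> x)) ` \<omega>)"
  have R: "finite R" "R \<noteq> {}" using assms by (auto simp: R_def)
  have "Max R < l"
    using R assms by (auto simp: Max_less_iff R_def pos_divide_less_eq)
  moreover have "0 \<le> Max R" using R by (intro Max_ge) (auto simp: R_def)
  moreover have "a \<delta> \<bullet> x \<le> Max R * (b \<delta> \<bullet> x)" if "\<delta> \<in> \<omega>" for \<delta>
  proof -
    have "(a \<delta> \<bullet> x) / (b \<delta> \<bullet> x) \<le> Max R" using R that by (intro Max_ge) (auto simp: R_def)
    then show ?thesis using b[OF that] by (simp add: pos_divide_le_eq)
  qed
  ultimately show thesis using that[of "Max R"] assms by (auto simp: feasible_def)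
qed

lemma card_le_of_all_constraints_needed:
  fixes X :: "(real^'d) set" and a b :: "'i \<Rightarrow> real^'d"
  assumes X: "convex X" "0 \<notin> X" and c: "strongly_convex_on X c" and fin: "finite \<beta>"
    and b: "\<And>x \<delta>. x \<in> X \<Longrightarrow> \<delta> \<in> \<beta> \<Longrightarrow> 0 < b \<delta> \<bullet> x"
    and opt: "is_optimal X a b c \<beta> p"
    and needed: "\<And>\<delta>. \<delta> \<in> \<beta> \<Longrightarrow>
      \<exists>q\<in>feasible X a b (\<beta> - {\<delta>}). lex_less (objective c q) (objective c p)"
  shows "card \<beta> \<le> CARD('d)"
proof (rule ccontr)
  assume "\<not> card \<beta> \<le> CARD('d)"
  then have big: "card \<beta> > DIM(real^'d)" by simp
  define L where "L = fst p"
  define k where "k = c (snd p)"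
  \<comment> \<open>At parameter \<open>L\<close> the constraint \<gamma> reads
    \<open>v \<gamma> \<bullet> x \<le> 0\<close>, which is homogeneous and so survives positive
    rescaling of \<open>x\<close>.\<close>
  define v where "v \<gamma> = a \<gamma> - L *\<^sub>R b \<gamma>" for \<gamma>
  have no_better: False if "q \<in> feasible X a b \<beta>" "lex_less (objective c q) (L, k)" for q
    using opt that
    by (force simp: is_optimal_def lex_le_def lex_less_def objective_def L_def k_def)
  have L0: "0 \<le> L" using opt by (cases p) (auto simp: is_optimal_def feasible_def L_def)
  obtain q where q: "\<And>\<delta>. \<delta> \<in> \<beta> \<Longrightarrow> q \<delta> \<in> feasible X a b (\<beta> - {\<delta>})"
    "\<And>\<delta>. \<delta> \<in> \<beta> \<Longrightarrow> lex_less (objective c (q \<delta>)) (L, k)"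
    using needed unfolding L_def k_def objective_def by metis
  define l where "l \<delta> = fst (q \<delta>)" for \<delta>
  define x where "x \<delta> = snd (q \<delta>)" for \<delta>
  define E where "E = {\<delta>\<in>\<beta>. l \<delta> < L}"
  have xX: "x \<delta> \<in> X" and l0: "0 \<le> l \<delta>"
    and le: "\<And>\<gamma>. \<gamma> \<in> \<beta> \<Longrightarrow> \<gamma> \<noteq> \<delta> \<Longrightarrow> a \<gamma> \<bullet> x \<delta> \<le> l \<delta> * (b \<gamma> \<bullet> x \<delta>)"
    and lL: "l \<delta> < L \<or> l \<delta> = L \<and> c (x \<delta>) < k"
    if "\<delta> \<in> \<beta>" for \<delta>
    using q[OF that]
    by (auto simp: feasible_def x_def l_def lex_less_def objective_def split: prod.splits)
  have vx: "v \<gamma> \<bullet> x \<delta> \<le> 0" if "\<delta> \<in> \<beta>" "\<gamma> \<in> \<beta>" "\<gamma> \<noteq> \<delta>" for \<gamma> \<delta>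
  proof -
    have "l \<delta> * (b \<gamma> \<bullet> x \<delta>) \<le> L * (b \<gamma> \<bullet> x \<delta>)"
      using lL[OF that(1)] b[OF xX[OF that(1)] that(2)] by (intro mult_right_mono) auto
    then show ?thesis using le[OF that] by (simp add: v_def inner_diff_left)
  qed
  have vxE: "v \<gamma> \<bullet> x \<delta> < 0" if "\<delta> \<in> E" "\<gamma> \<in> \<beta>" "\<gamma> \<noteq> \<delta>" for \<gamma> \<delta>
  \<comment> \<open>Positivity of \<open>b \<gamma> \<bullet> x \<delta>\<close> turns the gap
    between \<open>l \<delta>\<close> and \<open>L\<close> into a strict inequality.\<close>
  proof -
    have "\<delta> \<in> \<beta>" using that by (simp add: E_def)
    moreover have "l \<delta> * (b \<gamma> \<bullet> x \<delta>) < L * (b \<gamma> \<bullet> x \<delta>)"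
      using that b[OF xX[OF \<open>\<delta> \<in> \<beta>\<close>] that(2)] by (intro mult_strict_right_mono) (auto simp: E_def)
    ultimately show ?thesis using le[of \<delta> \<gamma>] that by (simp add: v_def inner_diff_left)
  qed
  define comb where "comb w K = (\<Sum>\<delta>\<in>K. w \<delta> *\<^sub>R x \<delta>)" for w :: "'i \<Rightarrow> real" and K
  \<comment> \<open>Only \<open>x \<gamma>\<close> itself may violate the constraint \<gamma>, hence
    the restriction to \<gamma> outside \<open>K\<close>. A single index in \<open>E\<close> makes
    the whole sum strict.\<close>
  have neg: "v \<gamma> \<bullet> comb w K \<le> 0" and neg_strict: "K \<inter> E \<noteq> {} \<Longrightarrow> v \<gamma> \<bullet> comb w K < 0"
    if "K \<subseteq> \<beta>" "\<And>\<delta>. \<delta> \<in> K \<Longrightarrow> 0 < w \<delta>" "\<gamma> \<in> \<beta>" "\<gamma> \<notin> K" for \<gamma> w K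
  proof -
    have eq: "v \<gamma> \<bullet> comb w K = (\<Sum>\<delta>\<in>K. w \<delta> * (v \<gamma> \<bullet> x \<delta>))"
      by (simp add: comb_def inner_sum_right)
    have terms: "w \<delta> * (v \<gamma> \<bullet> x \<delta>) \<le> 0" if "\<delta> \<in> K" for \<delta>
      using vx[of \<delta> \<gamma>] that \<open>K \<subseteq> \<beta>\<close> \<open>\<gamma> \<in> \<beta>\<close> \<open>\<gamma> \<notin> K\<close> \<open>\<And>\<delta>. \<delta> \<in> K \<Longrightarrow> 0 < w \<delta>\<close>[of \<delta>]
      by (intro mult_nonneg_nonpos) auto
    then show "v \<gamma> \<bullet> comb w K \<le> 0" unfolding eq by (rule sum_nonpos)
    assume "K \<inter> E \<noteq> {}"
    then obtain \<delta> where \<delta>: "\<delta> \<in> K" "\<delta> \<in> E" by blast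
    then have "w \<delta> * (v \<gamma> \<bullet> x \<delta>) < 0"
      using vxE[of \<delta> \<gamma>] that by (intro mult_pos_neg) auto
    then have "(\<Sum>\<delta>\<in>K. w \<delta> * (v \<gamma> \<bullet> x \<delta>)) < (\<Sum>\<delta>\<in>K. 0)"
      using \<delta> terms finite_subset[OF \<open>K \<subseteq> \<beta>\<close> fin] by (intro sum_strict_mono_ex1) auto
    then show "v \<gamma> \<bullet> comb w K < 0" unfolding eq by simp
  qed
  \<comment> \<open>Both claims test the optimum against the rescaled point \<open>z\<close> of
    \<open>X\<close>: without indices in \<open>E\<close> it has smaller \<open>c\<close> at
    parameter \<open>L\<close>, and with all inequalities strict it admits a parameter below
    \<open>L\<close>.\<close>
  have hit: "K \<inter> E \<noteq> {}" and not_strict: "K \<inter> E \<noteq> {} \<Longrightarrow> \<not> (\<forall>\<gamma>\<in>\<beta>. v \<gamma> \<bullet> comb w K < 0)"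
    if K: "K \<subseteq> \<beta>" "K \<noteq> {}" and w: "\<And>\<delta>. \<delta> \<in> K \<Longrightarrow> 0 < w \<delta>"
      and y: "\<And>\<gamma>. \<gamma> \<in> \<beta> \<Longrightarrow> v \<gamma> \<bullet> comb w K \<le> 0" for w K
  proof -
    have finK: "finite K" using K fin finite_subset by blast
    define z where "z = (1 / sum w K) *\<^sub>R comb w K"
    have s: "0 < sum w K" using finK K w by (intro sum_pos) auto
    have zX: "z \<in> X"
      unfolding z_def comb_def using K w xX X finK by (intro convex_normalized_sum) auto
    have vz: "v \<gamma> \<bullet> z = (v \<gamma> \<bullet> comb w K) / sum w K" for \<gamma> by (simp add: z_def)
    show "K \<inter> E \<noteq> {}"
    proof
      assume "K \<inter> E = {}"
      then have "x \<delta> \<in> {x\<in>X. c x < k}" if "\<delta> \<in> K" for \<delta>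
        using that lL[of \<delta>] xX[of \<delta>] K by (auto simp: E_def)
      then have "z \<in> {x\<in>X. c x < k}"
        unfolding z_def comb_def using K w finK convex_strict_sublevel[OF c]
        by (intro convex_normalized_sum) auto
      moreover have "v \<gamma> \<bullet> z \<le> 0" if "\<gamma> \<in> \<beta>" for \<gamma>
        using y[OF that] s by (simp add: vz divide_nonpos_pos)
      ultimately show False
        using no_better[of "(L, z)"] L0
        by (auto simp: feasible_def v_def inner_diff_left lex_less_def objective_def)
    qed
    \<comment> \<open>Some nonnegative parameter lies below \<open>L\<close>, so \<open>L\<close> is
      positive and can be lowered.\<close>
    assume "K \<inter> E \<noteq> {}"
    then obtain \<delta> where "\<delta> \<in> \<beta>" "l \<delta> < L" by (auto simp: E_def)
    then have L: "0 < L" using l0[of \<delta>] by linarith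
    show "\<not> (\<forall>\<gamma>\<in>\<beta>. v \<gamma> \<bullet> comb w K < 0)"
    proof
      assume "\<forall>\<gamma>\<in>\<beta>. v \<gamma> \<bullet> comb w K < 0"
      then have "v \<gamma> \<bullet> z < 0" if "\<gamma> \<in> \<beta>" for \<gamma>
        using that s by (simp add: vz divide_neg_pos)
      then have "a \<gamma> \<bullet> z < L * (b \<gamma> \<bullet> z)" if "\<gamma> \<in> \<beta>" for \<gamma>
        using that by (simp add: v_def inner_diff_left)
      then obtain l' where "l' < L" "(l', z) \<in> feasible X a b \<beta>"
        using feasible_smaller_parameter[OF fin zX L, of b a] b[OF zX] by blast
      then show False using no_better[of "(l', z)"] by (auto simp: lex_less_def objective_def)
    qed
  qed
  obtain u where u: "(\<Sum>\<delta>\<in>\<beta>. u \<delta> *\<^sub>R x \<delta>) = 0" "\<exists>\<delta>\<in>\<beta>. u \<delta> \<noteq> 0"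
    using linear_dependence_of_card_gt_dim[OF fin big] by blast
  define I where "I = {\<delta>\<in>\<beta>. 0 < u \<delta>}"
  define J where "J = {\<delta>\<in>\<beta>. u \<delta> < 0}"
  have IJ: "I \<subseteq> \<beta>" "J \<subseteq> \<beta>" "I \<inter> J = {}" "finite I" "finite J"
    using fin by (auto simp: I_def J_def)
  have "(\<Sum>\<delta>\<in>\<beta>. u \<delta> *\<^sub>R x \<delta>) = (\<Sum>\<delta>\<in>I \<union> J. u \<delta> *\<^sub>R x \<delta>)"
    using fin by (intro sum.mono_neutral_right) (auto simp: I_def J_def not_less)
  also have "\<dots> = comb u I - comb (\<lambda>\<delta>. - u \<delta>) J"
    using IJ by (simp add: sum.union_disjoint comb_def sum_negf)
  finally have eq: "comb u I = comb (\<lambda>\<delta>. - u \<delta>) J" using u by simp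
  have comb_nz: "comb w K \<noteq> 0" if "K \<subseteq> \<beta>" "K \<noteq> {}" "\<And>\<delta>. \<delta> \<in> K \<Longrightarrow> 0 < w \<delta>" for w K
  proof
    assume "comb w K = 0"
    moreover have "(1 / sum w K) *\<^sub>R comb w K \<in> X"
      unfolding comb_def using xX subsetD[OF that(1)]
      by (intro convex_normalized_sum[OF X(1) finite_subset[OF that(1) fin] that(2,3)]) blast+
    ultimately show False using X(2) by simp
  qed
  have wI: "\<And>\<delta>. \<delta> \<in> I \<Longrightarrow> 0 < u \<delta>" and wJ: "\<And>\<delta>. \<delta> \<in> J \<Longrightarrow> 0 < - u \<delta>"
    by (auto simp: I_def J_def)
  have empty: "comb w {} = 0" for w by (simp add: comb_def)
  \<comment> \<open>Both sides of \<open>eq\<close> are the same vector, and each is nonzero exactly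
    when its index set is nonempty, so neither set can be empty alone.\<close>
  have "I \<noteq> {} \<or> J \<noteq> {}" using u(2) by (auto simp: I_def J_def neq_iff)
  moreover have "I \<noteq> {} \<longleftrightarrow> comb u I \<noteq> 0"
    using comb_nz[where w = u, OF IJ(1) _ wI] empty by blast
  moreover have "J \<noteq> {} \<longleftrightarrow> comb u I \<noteq> 0"
    using comb_nz[where w = "\<lambda>\<delta>. - u \<delta>", OF IJ(2) _ wJ] empty unfolding eq by blast
  ultimately have ne: "I \<noteq> {}" "J \<noteq> {}" by simp_all
  have outside: "\<gamma> \<notin> I \<or> \<gamma> \<notin> J" for \<gamma> using IJ(3) by blast
  \<comment> \<open>For each \<gamma>, use whichever of the two representations of the common vector
    omits \<open>x \<gamma>\<close>.\<close>
  have nonpos: "v \<gamma> \<bullet> comb u I \<le> 0" if "\<gamma> \<in> \<beta>" for \<gamma>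
    using outside[of \<gamma>]
      neg[where w = u, OF IJ(1) wI that]
      neg[where w = "\<lambda>\<delta>. - u \<delta>", OF IJ(2) wJ that]
    unfolding eq by blast
  have hitI: "I \<inter> E \<noteq> {}" by (rule hit[where w = u, OF IJ(1) ne(1) wI nonpos])
  have hitJ: "J \<inter> E \<noteq> {}" by (rule hit[where w = "\<lambda>\<delta>. - u \<delta>", OF IJ(2) ne(2) wJ nonpos[unfolded eq]])
  \<comment> \<open>Both index sets meet \<open>E\<close>, so the inequality is strict whichever
    representation is used.\<close>
  have "v \<gamma> \<bullet> comb u I < 0" if "\<gamma> \<in> \<beta>" for \<gamma>
    using outside[of \<gamma>]
      neg_strict[where w = u, OF IJ(1) wI that _ hitI]
      neg_strict[where w = "\<lambda>\<delta>. - u \<delta>", OF IJ(2) wJ that _ hitJ]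
    unfolding eq by blast
  then show False using not_strict[where w = u, OF IJ(1) ne(1) wI nonpos hitI] by blast
qed

theorem theorem2:
  fixes X :: "(real^'d) set"
    and \<Delta> \<omega> \<beta> :: "'i set"
    and a b :: "'i \<Rightarrow> real^'d"
    and c :: "real^'d \<Rightarrow> real"
  assumes "compact X" and "convex X" and "interior X \<noteq> {}" and "0 \<notin> X"
    and "\<forall>x\<in>X. \<forall>\<delta>\<in>\<Delta>. b \<delta> \<bullet> x > 0"
    and "strongly_convex_on X c"
    and "finite \<omega>" and "\<omega> \<subseteq> \<Delta>"
    and "essential_set X a b c \<omega> \<beta>"
  shows "card \<beta> \<le> CARD('d)"
proof -
  note c = \<open>strongly_convex_on X c\<close>
  have \<beta>: "\<beta> \<subseteq> \<omega>" "Cost X a b c \<beta> = Cost X a b c \<omega>" "Cost X a b c \<omega> \<noteq> None"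
    and minimal: "\<And>\<gamma>. \<gamma> \<subseteq> \<omega> \<Longrightarrow> Cost X a b c \<gamma> = Cost X a b c \<omega> \<Longrightarrow> card \<beta> \<le> card \<gamma>"
    using assms(9) unfolding essential_set_def by auto
  have fin: "finite \<beta>" using \<beta>(1) \<open>finite \<omega>\<close> finite_subset by blast
  obtain p where p: "is_optimal X a b c \<beta> p"
    using \<beta> by (metis Cost_def)
  \<comment> \<open>Otherwise \<open>p\<close> would remain optimal after deleting \<delta>, giving
    a smaller subset of \<omega> with the same cost.\<close>
  have "\<exists>q\<in>feasible X a b (\<beta> - {\<delta>}). lex_less (objective c q) (objective c p)"
    if \<delta>: "\<delta> \<in> \<beta>" for \<delta>
  proof (rule ccontr)
    assume "\<not> ?thesis"
    then have "\<forall>q\<in>feasible X a b (\<beta> - {\<delta>}). lex_le (objective c p) (objective c q)"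
      by (force simp: lex_le_def lex_less_def prod_eq_iff)
    moreover have "p \<in> feasible X a b (\<beta> - {\<delta>})"
      using p by (auto simp: is_optimal_def feasible_def)
    ultimately have "is_optimal X a b c (\<beta> - {\<delta>}) p" by (simp add: is_optimal_def)
    then have "Cost X a b c (\<beta> - {\<delta>}) = Cost X a b c \<omega>"
      using Cost_eq_Some(2)[OF c] p \<beta>(2) by metis
    then have "card \<beta> \<le> card (\<beta> - {\<delta>})" using minimal \<beta>(1) by blast
    then show False using card_Diff1_less[OF fin \<delta>] by simp
  qed
  then show ?thesis
    using card_le_of_all_constraints_needed[OF \<open>convex X\<close> \<open>0 \<notin> X\<close> c fin _ p] assms(5,8) \<beta>(1)
    by blast
qed

end
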